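(* For every low-level program $c^L \in \mathrm{Prog}^L$ and all program-as-resource assertions $\mathcal{P}, \mathcal{Q} \subseteq \Sigma^L \times \Sigma^H \times \mathrm{Prog}^H$, the relational Hoare triple $\langle \mathcal{P}\rangle\, c^L\, \langle \mathcal{Q}\rangle$ is valid if and only if for every $X \subseteq \Sigma^H$ the standard Hoare triple $\{\mathrm{enc}_X(\mathcal{P})\}\, c^L\, \{\mathrm{enc}_X(\mathcal{Q})\}$ is $\forall$-valid.
   Context: $\Sigma^L$ and $\Sigma^H$ are sets of low-level and high-level program states; $\mathrm{Prog}^L$ and $\mathrm{Prog}^H$ are sets of low-level and high-level programs. Each program $c$ over a state set $\Sigma$ has a denotational semantics $[\![c]\!] \subseteq \Sigma\times\Sigma$, where $(\sigma,\sigma')\in[\![c]\!]$ means that executing $c$ from $\sigma$ can terminate in $\sigma'$ (programs may be nondeterministic). Assertions are sets, and $s \models P$ means $s\in P$. Standard triple: $\{P\}\,c\,\{Q\}$ (with $P,Q\subseteq\Sigma$) is $\forall$-valid if for all $\sigma_1\models P$ and all $\sigma_2$ with $(\sigma_1,\sigma_2)\in[\![c]\!]$ we have $\sigma_2\models Q$. Configuration refinement: $(\sigma_1,c_1)\hookrightarrow(\sigma_2,c_2)$ iff for every state $\sigma_3$, $(\sigma_2,\sigma_3)\in[\![c_2]\!]$ implies $(\sigma_1,\sigma_3)\in[\![c_1]\!]$. Relational triple: $\langle\mathcal{P}\rangle\,c^L\,\langle\mathcal{Q}\rangle$ is valid if for every $(\sigma^L_1,\sigma^H_1,c^H_1)\models\mathcal{P}$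 and every $\sigma^L_2$ with $(\sigma^L_1,\sigma^L_2)\in[\![c^L]\!]$, there exist $\sigma^H_2\in\Sigma^H$ and $c^H_2\in\mathrm{Prog}^H$ such that $(\sigma^H_1,c^H_1)\hookrightarrow(\sigma^H_2,c^H_2)$ and $(\sigma^L_2,\sigma^H_2,c^H_2)\models\mathcal{Q}$. Weakest (liberal) precondition: $\sigma\models\mathrm{wlp}(c,X)$ iff for all $\sigma_0$, $(\sigma,\sigma_0)\in[\![c]\!]$ implies $\sigma_0\in X$. Assertion encoding: for $X\subseteq\Sigma^H$, $\mathrm{enc}_X(\mathcal{P})\subseteq\Sigma^L$ is defined by: $\sigma^L\models\mathrm{enc}_X(\mathcal{P})$ iff there exist $\sigma^H\in\Sigma^H$, $c^H\in\mathrm{Prog}^H$ with $(\sigma^L,\sigma^H,c^H)\models\mathcal{P}$ and $\sigma^H\models\mathrm{wlp}(c^H,X)$. *)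

theory Defs imports Main begin

text \<open>
  States and programs are arbitrary types. A denotational semantics is a function
  \<open>sem :: 'prog \<Rightarrow> 'state rel\<close>, which each notion below takes as an explicit parameter, so that
  the same definition serves both the low-level and the high-level language.
\<close>

type_synonym ('prog, 'state) semantics = "'prog \<Rightarrow> 'state rel"

type_synonym ('ls, 'hs, 'hp) rassertion = "('ls \<times> 'hs \<times> 'hp) set"

definition hoare_valid ::
  "('prog, 'state) semantics \<Rightarrow> 'state set \<Rightarrow> 'prog \<Rightarrow> 'state set \<Rightarrow> bool" where
  "hoare_valid sem P c Q \<longleftrightarrow> (\<forall>\<sigma>\<^sub>1 \<sigma>\<^sub>2. \<sigma>\<^sub>1 \<in> P \<longrightarrow> (\<sigma>\<^sub>1, \<sigma>\<^sub>2) \<in> sem c \<longrightarrow> \<sigma>\<^sub>2 \<in> Q)"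

definition config_refines ::
  "('prog, 'state) semantics \<Rightarrow> 'state \<times> 'prog \<Rightarrow> 'state \<times> 'prog \<Rightarrow> bool" where
  "config_refines sem = (\<lambda>(\<sigma>\<^sub>1, c\<^sub>1) (\<sigma>\<^sub>2, c\<^sub>2).
     \<forall>\<sigma>\<^sub>3. (\<sigma>\<^sub>2, \<sigma>\<^sub>3) \<in> sem c\<^sub>2 \<longrightarrow> (\<sigma>\<^sub>1, \<sigma>\<^sub>3) \<in> sem c\<^sub>1)"

definition rel_hoare_valid ::
  "('lp, 'ls) semantics \<Rightarrow> ('hp, 'hs) semantics \<Rightarrow>
   ('ls, 'hs, 'hp) rassertion \<Rightarrow> 'lp \<Rightarrow> ('ls, 'hs, 'hp) rassertion \<Rightarrow> bool" where
  "rel_hoare_valid semL semH \<P> cL \<Q> \<longleftrightarrow>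
     (\<forall>\<sigma>L\<^sub>1 \<sigma>H\<^sub>1 cH\<^sub>1 \<sigma>L\<^sub>2. (\<sigma>L\<^sub>1, \<sigma>H\<^sub>1, cH\<^sub>1) \<in> \<P> \<longrightarrow> (\<sigma>L\<^sub>1, \<sigma>L\<^sub>2) \<in> semL cL \<longrightarrow>
        (\<exists>\<sigma>H\<^sub>2 cH\<^sub>2. config_refines semH (\<sigma>H\<^sub>1, cH\<^sub>1) (\<sigma>H\<^sub>2, cH\<^sub>2) \<and> (\<sigma>L\<^sub>2, \<sigma>H\<^sub>2, cH\<^sub>2) \<in> \<Q>))"

definition wlp :: "('prog, 'state) semantics \<Rightarrow> 'prog \<Rightarrow> 'state set \<Rightarrow> 'state set" where
  "wlp sem c X = {\<sigma>. \<forall>\<sigma>\<^sub>0. (\<sigma>, \<sigma>\<^sub>0) \<in> sem c \<longrightarrow> \<sigma>\<^sub>0 \<in> X}"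

definition enc ::
  "('hp, 'hs) semantics \<Rightarrow> 'hs set \<Rightarrow> ('ls, 'hs, 'hp) rassertion \<Rightarrow> 'ls set" where
  "enc semH X \<P> = {\<sigma>L. \<exists>\<sigma>H cH. (\<sigma>L, \<sigma>H, cH) \<in> \<P> \<and> \<sigma>H \<in> wlp semH cH X}"

end

theory Submission imports Defs begin

text \<open>Refinement is then inclusion between two outcome sets, and \<open>wlp\<close> is
  inclusion of one in \<open>X\<close>. One direction is transitivity of inclusion; the other takes
  for \<open>X\<close> the outcome set of the initial configuration, as in a Yoneda
  argument.\<close>

lemma config_refines_iff_Image:
  "config_refines sem (\<sigma>\<^sub>1, c\<^sub>1) (\<sigma>\<^sub>2, c\<^sub>2) \<longleftrightarrow> sem c\<^sub>2 `` {\<sigma>\<^sub>2} \<subseteq> sem c\<^sub>1 `` {\<sigma>\<^sub>1}"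
  unfolding config_refines_def by auto

lemma mem_wlp_iff_Image: "\<sigma> \<in> wlp sem c X \<longleftrightarrow> sem c `` {\<sigma>} \<subseteq> X"
  unfolding wlp_def by auto

theorem theorem4:
  fixes semL :: "('lp, 'ls) semantics"
    and semH :: "('hp, 'hs) semantics"
    and cL :: 'lp
    and \<P> \<Q> :: "('ls, 'hs, 'hp) rassertion"
  shows "rel_hoare_valid semL semH \<P> cL \<Q> \<longleftrightarrow>
    (\<forall>X :: 'hs set. hoare_valid semL (enc semH X \<P>) cL (enc semH X \<Q>))"
proof (intro iffI allI)
  fix X :: "'hs set"
  assume "rel_hoare_valid semL semH \<P> cL \<Q>"
  then show "hoare_valid semL (enc semH X \<P>) cL (enc semH X \<Q>)"
    unfolding rel_hoare_valid_def hoare_valid_def enc_def mem_Collect_eq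
      config_refines_iff_Image mem_wlp_iff_Image
    \<comment> \<open>The configuration given by the relational triple serves for every
      \<open>X\<close>: its outcomes are among the initial ones, which lie in
      \<open>X\<close>.\<close>
    by (meson order_trans)
next
  assume valid: "\<forall>X :: 'hs set. hoare_valid semL (enc semH X \<P>) cL (enc semH X \<Q>)"
  show "rel_hoare_valid semL semH \<P> cL \<Q>"
    unfolding rel_hoare_valid_def
  proof (intro allI impI)
    fix \<sigma>L\<^sub>1 \<sigma>H\<^sub>1 cH\<^sub>1 \<sigma>L\<^sub>2
    assume pre: "(\<sigma>L\<^sub>1, \<sigma>H\<^sub>1, cH\<^sub>1) \<in> \<P>" and step: "(\<sigma>L\<^sub>1, \<sigma>L\<^sub>2) \<in> semL cL"
    \<comment> \<open>The strongest postcondition of the initial high-level configuration: a configuration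
      satisfies \<open>wlp\<close> for this set exactly if it refines the initial one.\<close>
    define X where "X = semH cH\<^sub>1 `` {\<sigma>H\<^sub>1}"
    \<comment> \<open>The initial configuration is itself the witness, by reflexivity of
      inclusion.\<close>
    have "\<sigma>L\<^sub>1 \<in> enc semH X \<P>"
      using pre unfolding enc_def mem_wlp_iff_Image X_def by blast
    then have "\<sigma>L\<^sub>2 \<in> enc semH X \<Q>"
      using valid step unfolding hoare_valid_def by blast
    then show "\<exists>\<sigma>H\<^sub>2 cH\<^sub>2. config_refines semH (\<sigma>H\<^sub>1, cH\<^sub>1) (\<sigma>H\<^sub>2, cH\<^sub>2) \<and> (\<sigma>L\<^sub>2, \<sigma>H\<^sub>2, cH\<^sub>2) \<in> \<Q>"
      unfolding enc_def mem_wlp_iff_Image config_refines_iff_Image X_def by blast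
  qed
qed

end
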